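(* Every nœtherian, atomistic, biatomic, join-semidistributive lattice $M$ with zero satisfies the quasi-identity $\theta$; that is, for all $a,b,c,u,v\in M$, if $$u\le a\vee b\vee v,\qquad v\le a\vee c\vee u,\qquad (a\vee u)\wedge(b\vee c)\le a,$$ $$(a\vee b)\wedge(a\vee u)=a,\qquad (a\vee c)\wedge(a\vee v)=a,\qquad (a\vee u)\wedge(a\vee v)=a,$$ then $u\le a$.
   Context: A partially ordered set is nœtherian if it has no infinite strictly increasing chain (equivalently, every nonempty subset has a maximal element). A lattice $M$ with least element $0$ is atomic if every nonzero element lies above an atom; atomistic if every element is a join of atoms ($0$ being the empty join); biatomic if it is atomic and for every atom $p$ and all nonzero $a,b\in M$ with $p\le a\vee b$, there are atoms $x\le a$ and $y\le b$ of $M$ with $p\le x\vee y$. A lattice $M$ is join-semidistributive if $x\vee y=x\vee z$ implies $x\vee y=x\vee(y\wedge z)$, for all $x,y,z\in M$. *)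

theory Defs
  imports Main "HOL-Library.Lub_Glb"
begin

text \<open>
  Partially ordered sets and lattices are modelled by types of the corresponding order class;
  a lattice with zero is a type of class \<^class>\<open>bounded_lattice_bot\<close>. Properties of
  the whole structure are predicates on \<open>TYPE('a)\<close>.
\<close>

definition noetherian :: "'a::order itself \<Rightarrow> bool" where
  "noetherian T \<longleftrightarrow> \<not> (\<exists>f :: nat \<Rightarrow> 'a. strict_mono f)"

definition atom :: "'a::order_bot \<Rightarrow> bool" where
  "atom p \<longleftrightarrow> bot < p \<and> \<not> (\<exists>x. bot < x \<and> x < p)"

definition atomic :: "'a::bounded_lattice_bot itself \<Rightarrow> bool" where
  "atomic T \<longleftrightarrow> (\<forall>x::'a. x \<noteq> bot \<longrightarrow> (\<exists>p. atom p \<and> p \<le> x))"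

text \<open>
  The lattice need not be complete, so a join of a set of atoms is expressed as a least upper
  bound. The set may be infinite or empty; in the latter case its join is \<^const>\<open>bot\<close>.
\<close>

definition atomistic :: "'a::bounded_lattice_bot itself \<Rightarrow> bool" where
  "atomistic T \<longleftrightarrow> (\<forall>x::'a. \<exists>A. (\<forall>p\<in>A. atom p) \<and> isLub UNIV A x)"

definition biatomic :: "'a::bounded_lattice_bot itself \<Rightarrow> bool" where
  "biatomic T \<longleftrightarrow> atomic TYPE('a) \<and>
     (\<forall>(p::'a) a b. atom p \<longrightarrow> a \<noteq> bot \<longrightarrow> b \<noteq> bot \<longrightarrow> p \<le> sup a b \<longrightarrow>
        (\<exists>x y. atom x \<and> x \<le> a \<and> atom y \<and> y \<le> b \<and> p \<le> sup x y))"

definition join_semidistributive :: "'a::lattice itself \<Rightarrow> bool" where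
  "join_semidistributive T \<longleftrightarrow>
     (\<forall>(x::'a) y z. sup x y = sup x z \<longrightarrow> sup x y = sup x (inf y z))"

end

theory Submission
  imports Defs
begin

text \<open>
  Suppose \<open>u \<not>\<le> a\<close>; then some atom below \<open>a \<squnion> u\<close> is not below \<open>a\<close>. Think of such an atom \<open>p\<close> as a
  point of a triangle with vertices \<open>a\<close>, \<open>b\<close>, \<open>c\<close> and measure how close it is to the vertex \<open>a\<close> by
  the element \<open>b \<squnion> c \<squnion> p\<close>: the closer, the larger. Biatomicity moves \<open>p\<close> towards \<open>a\<close> in two steps:
  since \<open>p \<le> b \<squnion> (a \<squnion> v)\<close>, the segment from \<open>b\<close> through \<open>p\<close> meets \<open>a \<squnion> v\<close> in an atom \<open>y\<close>, and since
  \<open>y \<le> c \<squnion> (a \<squnion> u)\<close>, the segment from \<open>c\<close> through \<open>y\<close> meets \<open>a \<squnion> u\<close> in an atom \<open>q\<close>. Then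
  \<open>b \<squnion> c \<squnion> p \<le> b \<squnion> c \<squnion> y \<le> b \<squnion> c \<squnion> q\<close>.

  As the lattice is noetherian, \<open>p\<close> can be chosen with \<open>b \<squnion> c \<squnion> p\<close> maximal, so that the three
  joins coincide. Now \<open>p\<close> and \<open>y\<close> are disjoint, because \<open>a \<squnion> u\<close> and \<open>a \<squnion> v\<close> meet in \<open>a\<close>, and
  join-semidistributivity turns \<open>b \<squnion> c \<squnion> p = b \<squnion> c \<squnion> y\<close> into \<open>p \<le> b \<squnion> c\<close>. But the part of \<open>a \<squnion> u\<close>
  below \<open>b \<squnion> c\<close> lies below \<open>a\<close>, a contradiction.
\<close>

lemma noetherian_has_maximal:
  fixes S :: "'a::order set"
  assumes noeth: "noetherian TYPE('a)" and nonempty: "S \<noteq> {}"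
  obtains m where "m \<in> S" "\<And>s. s \<in> S \<Longrightarrow> m \<le> s \<Longrightarrow> s = m"
proof -
  have "wf {(y, x :: 'a). x < y}"
    using noeth unfolding wf_iff_no_infinite_down_chain noetherian_def
    by (auto simp: strict_mono_Suc_iff)
  then obtain m where "m \<in> S" "\<And>s. m < s \<Longrightarrow> s \<notin> S"
    using nonempty by (metis (mono_tags, lifting) case_prodI ex_in_conv mem_Collect_eq wfE_min)
  then show thesis
    using that by (metis order.order_iff_strict)
qed

lemma atomistic_separating_atom:
  fixes x y :: "'a::bounded_lattice_bot"
  assumes "atomistic TYPE('a)" "\<not> x \<le> y"
  obtains p where "atom p" "p \<le> x" "\<not> p \<le> y"
proof -
  obtain A where atoms: "\<forall>p\<in>A. atom p" and lub: "isLub UNIV A x"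
    using assms(1) unfolding atomistic_def by blast
  have "\<exists>p\<in>A. \<not> p \<le> y"
    using lub assms(2) by (auto simp: isLub_def leastP_def isUb_def setle_def setge_def)
  moreover have "p \<le> x" if "p \<in> A" for p
    using lub that by (auto simp: isLub_def leastP_def isUb_def setle_def)
  ultimately show thesis
    using atoms that by blast
qed

lemma atom_inf_eq_bot:
  fixes p x :: "'a::bounded_lattice_bot"
  assumes "atom p" "\<not> p \<le> x"
  shows "inf p x = bot"
  using assms unfolding atom_def
  by (metis bot.not_eq_extremum inf.absorb_iff1 inf_le1 order.not_eq_order_implies_strict)

text \<open>
  One projection step: the segment from \<open>b\<close> through \<open>p\<close> is prolonged until it meets \<open>e\<close>. The
  degenerate case \<open>b = bot\<close>, which biatomicity does not cover, is excluded by \<open>\<not> p \<le> e\<close>, and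
  \<open>e = bot\<close> by \<open>\<not> p \<le> b\<close>.
\<close>

lemma biatomic_project:
  fixes p b e :: "'a::bounded_lattice_bot"
  assumes "biatomic TYPE('a)" "atom p" "p \<le> sup b e" "\<not> p \<le> b" "\<not> p \<le> e"
  obtains y where "atom y" "y \<le> e" "p \<le> sup b y"
proof -
  have "b \<noteq> bot" "e \<noteq> bot"
    using assms(3-5) by auto
  then obtain x y where "x \<le> b" "atom y" "y \<le> e" "p \<le> sup x y"
    using assms(1-3) unfolding biatomic_def by metis
  moreover from \<open>x \<le> b\<close> have "sup x y \<le> sup b y"
    by (rule sup_mono) simp
  ultimately show thesis
    using that by (metis order.trans)
qed

theorem theorem7p1:
  fixes a b c u v :: "'a::bounded_lattice_bot"
  assumes "noetherian TYPE('a)"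
    and "atomistic TYPE('a)"
    and "biatomic TYPE('a)"
    and "join_semidistributive TYPE('a)"
    and "u \<le> sup (sup a b) v"
    and "v \<le> sup (sup a c) u"
    and "inf (sup a u) (sup b c) \<le> a"
    and "inf (sup a b) (sup a u) = a"
    and "inf (sup a c) (sup a v) = a"
    and "inf (sup a u) (sup a v) = a"
  shows "u \<le> a"
proof (rule ccontr)
  assume "\<not> u \<le> a"
  then obtain p0 where "atom p0" "p0 \<le> u" "\<not> p0 \<le> a"
    using atomistic_separating_atom assms(2) by blast
  \<comment> \<open>The atoms range over those below \<open>a \<squnion> u\<close> rather than \<open>u\<close>, since projecting back
    from \<open>y\<close> only lands below \<open>a \<squnion> u\<close>.\<close>
  define P where "P = {p. atom p \<and> p \<le> sup a u \<and> \<not> p \<le> a}"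
  have "p0 \<in> P"
    using \<open>atom p0\<close> \<open>p0 \<le> u\<close> \<open>\<not> p0 \<le> a\<close> by (auto simp: P_def intro: le_supI2)
  then have "sup (sup b c) ` P \<noteq> {}"
    by blast
  then obtain m where "m \<in> sup (sup b c) ` P"
    and m_max: "\<And>s. s \<in> sup (sup b c) ` P \<Longrightarrow> m \<le> s \<Longrightarrow> s = m"
    using noetherian_has_maximal[OF assms(1)] by metis
  then obtain p where p: "p \<in> P"
    and p_max: "\<And>q. q \<in> P \<Longrightarrow> sup (sup b c) p \<le> sup (sup b c) q \<Longrightarrow>
      sup (sup b c) q = sup (sup b c) p"
    by blast
  have "atom p" "p \<le> sup a u" "\<not> p \<le> a"
    using p by (auto simp: P_def)

  have p_ab: "\<not> p \<le> sup a b"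
    using \<open>p \<le> sup a u\<close> \<open>\<not> p \<le> a\<close> assms(8) by (metis le_infI)
  have p_av: "\<not> p \<le> sup a v"
    using \<open>p \<le> sup a u\<close> \<open>\<not> p \<le> a\<close> assms(10) by (metis le_infI)
  have "sup a u \<le> sup b (sup a v)"
    using assms(5) by (simp add: ac_simps le_supI1)
  then have "p \<le> sup b (sup a v)"
    using \<open>p \<le> sup a u\<close> by (rule order.trans[rotated])
  moreover have "\<not> p \<le> b"
    using p_ab by (auto intro: le_supI2)
  ultimately obtain y where y: "atom y" "y \<le> sup a v" "p \<le> sup b y"
    using biatomic_project[OF assms(3) \<open>atom p\<close>] p_av by blast

  have "\<not> y \<le> a"
  proof
    assume "y \<le> a"
    then have "sup b y \<le> sup a b"
      by (simp add: le_supI1)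
    with y(3) p_ab show False
      by (blast dest: order.trans)
  qed
  have y_ac: "\<not> y \<le> sup a c"
    using y(2) \<open>\<not> y \<le> a\<close> assms(9) by (metis le_infI)
  have y_au: "\<not> y \<le> sup a u"
    using y(2) \<open>\<not> y \<le> a\<close> assms(10) by (metis le_infI)
  have "sup a v \<le> sup c (sup a u)"
    using assms(6) by (simp add: ac_simps le_supI1)
  then have "y \<le> sup c (sup a u)"
    using y(2) by (rule order.trans[rotated])
  moreover have "\<not> y \<le> c"
    using y_ac by (auto intro: le_supI2)
  ultimately obtain q where q: "atom q" "q \<le> sup a u" "y \<le> sup c q"
    using biatomic_project[OF assms(3) y(1)] y_au by blast
  have "\<not> q \<le> a"
  proof
    assume "q \<le> a"
    then have "sup c q \<le> sup a c"
      by (simp add: le_supI1)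
    with q(3) y_ac show False
      by (blast dest: order.trans)
  qed
  then have "q \<in> P"
    using q by (simp add: P_def)

  have py: "sup (sup b c) p \<le> sup (sup b c) y"
  proof -
    have "sup b y \<le> sup (sup b c) y"
      by (simp add: le_supI1)
    then show ?thesis
      using y(3) by (meson order.trans sup_ge1 le_sup_iff)
  qed
  have yq: "sup (sup b c) y \<le> sup (sup b c) q"
  proof -
    have "sup c q \<le> sup (sup b c) q"
      by (simp add: le_supI1)
    then show ?thesis
      using q(3) by (meson order.trans sup_ge1 le_sup_iff)
  qed
  have "sup (sup b c) q = sup (sup b c) p"
    using p_max \<open>q \<in> P\<close> order.trans[OF py yq] by blast
  with py yq have "sup (sup b c) p = sup (sup b c) y"
    by (metis order.antisym)
  then have "sup (sup b c) p = sup (sup b c) (inf p y)"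
    using assms(4) unfolding join_semidistributive_def by blast
  moreover have "inf p y = bot"
    using atom_inf_eq_bot[OF \<open>atom p\<close>] p_av y(2) by (meson order.trans)
  ultimately have "p \<le> sup b c"
    by (metis sup_bot_right sup_ge2)
  then have "p \<le> a"
    using \<open>p \<le> sup a u\<close> assms(7) by (meson le_infI order.trans)
  with \<open>\<not> p \<le> a\<close> show False ..
qed

end
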